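(* Let $(P,+,\cdot,0,1)$ be a finite dual of a Boolean poset. Define $x\le y$ if $x\cdot y=x$, and $x':=x+1$, for $x,y\in P$. Then $(P,\le,{}',0,1)$ is a Boolean poset.
   Context: A dual of a Boolean poset is a structure $(P,+,\cdot,0,1)$ where $+,\cdot$ are binary operators on $P$ (defined on pairs of elements and of subsets, with values subsets of $P$; elements identified with singletons), $0,1\in P$, such that for all $x,y,z\in P$ and $A,B\subseteq P$: (i) $x\cdot x=x$, $x\cdot y=y\cdot x$, $x\cdot0=0$, $x\cdot1=x$, $(x\cdot(y\cdot z))\cdot z=(x\cdot(y\cdot z))\cdot1$; (ii) $(x+1)+1=x$; (iii) $x\cdot y=x$ implies $(x+1)\cdot(y+1)=y+1$; (iv) $x\cdot(x+1)=0$; (v) $\Big(\big((x+1)\cdot(y+1)\big)+1\Big)\cdot z=\Big(\big(((x\cdot z)+1)\cdot((y\cdot z)+1)\big)+1\Big)\cdot1$; (vi) $x\in A\cdot B$ if and only if [$x\cdot y=x$ for all $y\in A\cup B$, and every $z\in P$ with $x\cdot z=x$ and $z\cdot y=z$ for all $y\in A\cup B$ satisfies $z=x$]. For a poset and $X\subseteq P$, $L(X)$, $U(X)$ are the sets of lower/upper bounds; $L(x,y)=L(\{x,y\})$, $LU(X)=L(U(X))$. A complemented poset is a bounded poset $(P,\le,{}',0,1)$ with an antitone involution $'$ such that $L(x,x')=\{0\}$, $U(x,x')=\{1\}$ for all $x$. A poset is distributive if $L(U(x,y),z)=LU(L(x,z),L(y,z))$ for all $x,y,z$. A Boolean poset is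 a distributive complemented poset. *)

theory Defs
  imports "HOL-Algebra.Order"
begin

locale complemented_poset = partial_order L for L (structure) +
  fixes compl :: "'a \<Rightarrow> 'a" and zero one :: 'a
  assumes zero_closed: "zero \<in> carrier L"
    and one_closed: "one \<in> carrier L"
    and zero_least: "x \<in> carrier L \<Longrightarrow> zero \<sqsubseteq> x"
    and one_greatest: "x \<in> carrier L \<Longrightarrow> x \<sqsubseteq> one"
    and compl_closed: "x \<in> carrier L \<Longrightarrow> compl x \<in> carrier L"
    and compl_antitone:
      "\<lbrakk>x \<in> carrier L; y \<in> carrier L; x \<sqsubseteq> y\<rbrakk> \<Longrightarrow> compl y \<sqsubseteq> compl x"
    and compl_compl: "x \<in> carrier L \<Longrightarrow> compl (compl x) = x"
    and Lower_compl: "x \<in> carrier L \<Longrightarrow> Lower L {x, compl x} = {zero}"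
    and Upper_compl: "x \<in> carrier L \<Longrightarrow> Upper L {x, compl x} = {one}"

locale boolean_poset = complemented_poset +
  assumes distributive:
    "\<lbrakk>x \<in> carrier L; y \<in> carrier L; z \<in> carrier L\<rbrakk> \<Longrightarrow>
      Lower L (Upper L {x, y} \<union> {z}) = Lower L (Upper L (Lower L {x, z} \<union> Lower L {y, z}))"

text \<open>
  The operators act on subsets of \<open>P\<close> and yield subsets of \<open>P\<close>; an element \<open>x\<close> is
  identified with the singleton \<open>{x}\<close>. In particular it is not assumed that
  \<open>{x} \<oplus> {one}\<close> is a singleton, nor that \<open>\<oplus>\<close> is computed elementwise on larger subsets.
\<close>

locale dual_of_boolean_poset =
  fixes P :: "'a set"
    and plus :: "'a set \<Rightarrow> 'a set \<Rightarrow> 'a set" (infixl "\<oplus>" 65)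
    and times :: "'a set \<Rightarrow> 'a set \<Rightarrow> 'a set" (infixl "\<odot>" 70)
    and zero one :: 'a
  assumes zero_in: "zero \<in> P"
    and one_in: "one \<in> P"
    and plus_subset: "\<lbrakk>A \<subseteq> P; B \<subseteq> P\<rbrakk> \<Longrightarrow> A \<oplus> B \<subseteq> P"
    and times_subset: "\<lbrakk>A \<subseteq> P; B \<subseteq> P\<rbrakk> \<Longrightarrow> A \<odot> B \<subseteq> P"
    and times_idem: "x \<in> P \<Longrightarrow> {x} \<odot> {x} = {x}"
    and times_commute: "\<lbrakk>x \<in> P; y \<in> P\<rbrakk> \<Longrightarrow> {x} \<odot> {y} = {y} \<odot> {x}"
    and times_zero: "x \<in> P \<Longrightarrow> {x} \<odot> {zero} = {zero}"
    and times_one: "x \<in> P \<Longrightarrow> {x} \<odot> {one} = {x}"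
    and times_absorb: "\<lbrakk>x \<in> P; y \<in> P; z \<in> P\<rbrakk> \<Longrightarrow>
      ({x} \<odot> ({y} \<odot> {z})) \<odot> {z} = ({x} \<odot> ({y} \<odot> {z})) \<odot> {one}"
    and plus_one_plus_one: "x \<in> P \<Longrightarrow> ({x} \<oplus> {one}) \<oplus> {one} = {x}"
    and plus_one_antitone: "\<lbrakk>x \<in> P; y \<in> P; {x} \<odot> {y} = {x}\<rbrakk> \<Longrightarrow>
      ({x} \<oplus> {one}) \<odot> ({y} \<oplus> {one}) = {y} \<oplus> {one}"
    and times_plus_one: "x \<in> P \<Longrightarrow> {x} \<odot> ({x} \<oplus> {one}) = {zero}"
    and distrib: "\<lbrakk>x \<in> P; y \<in> P; z \<in> P\<rbrakk> \<Longrightarrow>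
      ((({x} \<oplus> {one}) \<odot> ({y} \<oplus> {one})) \<oplus> {one}) \<odot> {z} =
      (((({x} \<odot> {z}) \<oplus> {one}) \<odot> (({y} \<odot> {z}) \<oplus> {one})) \<oplus> {one}) \<odot> {one}"
    and mem_times_iff: "\<lbrakk>A \<subseteq> P; B \<subseteq> P; x \<in> P\<rbrakk> \<Longrightarrow>
      x \<in> A \<odot> B \<longleftrightarrow>
        (\<forall>y\<in>A \<union> B. {x} \<odot> {y} = {x}) \<and>
        (\<forall>z\<in>P. {x} \<odot> {z} = {x} \<and> (\<forall>y\<in>A \<union> B. {z} \<odot> {y} = {z}) \<longrightarrow> z = x)"

end

theory Submission
  imports Defs
begin

text \<open>
  By axiom (vi), \<open>A \<odot> B\<close> is the set of maximal lower bounds of \<open>A \<union> B\<close>, so in the finite case it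
  determines all lower bounds of \<open>A \<union> B\<close>. Axiom (iii) with \<open>x = y\<close> says that \<open>{x} \<oplus> {one}\<close> is
  its own set of maximal lower bounds, which forces it to be a singleton \<open>{x'}\<close>.
  Nothing is known about \<open>({x'} \<odot> {y'}) \<oplus> {one}\<close> when the product is not a singleton, but
  axiom (v) determines its set \<open>E x y\<close> of lower bounds. Its instance \<open>E z' y \<inter> L(z) = L(y, z)\<close>
  shows that \<open>z \<le> y\<close> whenever \<open>z\<close> and \<open>y'\<close> are disjoint, since then \<open>E z' y = P\<close>. This
  property gives \<open>E x y = LU(x, y)\<close> and then distributivity.
\<close>

locale finite_dual_of_boolean_poset = dual_of_boolean_poset +
  assumes finite_P: "finite P"
begin

definition below :: "'a \<Rightarrow> 'a \<Rightarrow> bool" (infix "\<preceq>" 50)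
  where "x \<preceq> y \<longleftrightarrow> {x} \<odot> {y} = {x}"

definition lower :: "'a set \<Rightarrow> 'a set"
  where "lower A = {x \<in> P. \<forall>y\<in>A. x \<preceq> y}"

definition compl :: "'a \<Rightarrow> 'a"
  where "compl x = the_elem ({x} \<oplus> {one})"

section \<open>The order induced by the product\<close>

lemma below_refl: "x \<in> P \<Longrightarrow> x \<preceq> x"
  by (simp add: below_def times_idem)

lemma below_antisym: "\<lbrakk>x \<in> P; y \<in> P; x \<preceq> y; y \<preceq> x\<rbrakk> \<Longrightarrow> x = y"
  using times_commute by (auto simp: below_def)

text \<open>Under the assumptions both sides of \<open>times_absorb\<close> collapse, leaving
  \<open>{x} \<odot> {z} = {x} \<odot> {one}\<close>.\<close>

lemma below_trans:
  assumes "x \<in> P" "y \<in> P" "z \<in> P" "x \<preceq> y" "y \<preceq> z"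
  shows "x \<preceq> z"
  using times_absorb[of x y z] assms by (simp add: below_def times_one)

lemma below_one: "x \<in> P \<Longrightarrow> x \<preceq> one"
  by (simp add: below_def times_one)

lemma zero_below: "x \<in> P \<Longrightarrow> zero \<preceq> x"
  using times_commute[of x zero] by (simp add: below_def times_zero zero_in)

lemma below_zero: "\<lbrakk>x \<in> P; x \<preceq> zero\<rbrakk> \<Longrightarrow> x = zero"
  by (auto simp: below_def times_zero)

lemma zero_in_lower: "A \<subseteq> P \<Longrightarrow> zero \<in> lower A"
  by (auto simp: lower_def zero_in zero_below)

section \<open>Products and sets of lower bounds\<close>

lemma mem_times_lower:
  assumes "A \<subseteq> P" "B \<subseteq> P"
  shows "x \<in> A \<odot> B \<longleftrightarrow> x \<in> lower (A \<union> B) \<and> (\<forall>z\<in>lower (A \<union> B). x \<preceq> z \<longrightarrow> z = x)"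
proof (cases "x \<in> P")
  case True
  then show ?thesis
    using mem_times_iff[OF assms True] by (auto simp: lower_def below_def)
next
  case False
  then show ?thesis using times_subset[OF assms] by (auto simp: lower_def)
qed

text \<open>The only place where finiteness enters: every lower bound extends to a maximal
  one.\<close>

lemma lower_below_times:
  assumes "A \<subseteq> P" "B \<subseteq> P" "w \<in> lower (A \<union> B)"
  shows "\<exists>m\<in>A \<odot> B. w \<preceq> m"
proof -
  define up where "up v = {z \<in> lower (A \<union> B). v \<preceq> z}" for v
  have wP: "w \<in> P" using assms by (simp add: lower_def)
  have fin: "finite (up v)" for v
    using finite_P by (auto simp: up_def lower_def)
  have "w \<in> up w" using assms wP by (simp add: up_def below_refl)
  \<comment> \<open>A bound above \<open>w\<close> with the fewest bounds above it is maximal: a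
    strictly larger \<open>z\<close> would have \<open>up z\<close> strictly inside
    \<open>up m\<close>, since \<open>m\<close> is missing there.\<close>
  then obtain m where m: "m \<in> up w" "\<And>z. z \<in> up w \<Longrightarrow> card (up m) \<le> card (up z)"
    using ex_has_least_nat[of "\<lambda>z. z \<in> up w" w "\<lambda>z. card (up z)"] by auto
  have mP: "m \<in> P" and wm: "w \<preceq> m" and ml: "m \<in> lower (A \<union> B)"
    using m(1) by (auto simp: up_def lower_def)
  have "z = m" if z: "z \<in> lower (A \<union> B)" "m \<preceq> z" for z
  proof (rule ccontr)
    assume ne: "z \<noteq> m"
    have zP: "z \<in> P" using z by (simp add: lower_def)
    have "z \<in> up w" using below_trans[OF wP mP zP wm z(2)] z by (simp add: up_def)
    moreover have "up z \<subseteq> up m"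
      using below_trans[OF mP zP _ z(2)] by (auto simp: up_def lower_def)
    moreover have "m \<notin> up z" using below_antisym[OF mP zP z(2)] ne by (auto simp: up_def)
    moreover have "m \<in> up m" using ml mP by (simp add: up_def below_refl)
    ultimately show False
      using m(2)[of z] psubset_card_mono[OF fin, of "up z" m] by force
  qed
  then show ?thesis using mem_times_lower[OF assms(1,2), of m] ml wm by blast
qed

text \<open>Lets an equation between products be read as an equation between sets of lower bounds,
  which is how axiom (v) is used.\<close>

lemma lower_eq_times:
  assumes "A \<subseteq> P" "B \<subseteq> P"
  shows "lower (A \<union> B) = {w \<in> P. \<exists>m\<in>A \<odot> B. w \<preceq> m}"
proof (intro equalityI subsetI)
  fix w assume "w \<in> lower (A \<union> B)"
  then show "w \<in> {w \<in> P. \<exists>m\<in>A \<odot> B. w \<preceq> m}"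
    using lower_below_times[OF assms] by (auto simp: lower_def)
next
  fix w assume "w \<in> {w \<in> P. \<exists>m\<in>A \<odot> B. w \<preceq> m}"
  then obtain m where m: "w \<in> P" "w \<preceq> m" "m \<in> lower (A \<union> B)"
    using mem_times_lower[OF assms] by auto
  then show "w \<in> lower (A \<union> B)"
    using assms below_trans[OF m(1) _ _ m(2)] by (auto simp: lower_def)
qed

lemma times_eq_zero:
  assumes "x \<in> P" "y \<in> P" "\<And>t. \<lbrakk>t \<in> P; t \<preceq> x; t \<preceq> y\<rbrakk> \<Longrightarrow> t = zero"
  shows "{x} \<odot> {y} = {zero}"
proof -
  have "lower ({x} \<union> {y}) = {zero}"
    by (auto simp: lower_def zero_in zero_below assms(1,2) intro: assms(3))
  then show ?thesis
    using mem_times_lower[of "{x}" "{y}"] assms(1,2) by auto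
qed

section \<open>The complement\<close>

lemma plus_one_singleton:
  assumes x: "x \<in> P"
  shows "\<exists>x'\<in>P. {x} \<oplus> {one} = {x'}"
proof -
  define C where "C = {x} \<oplus> {one}"
  have CP: "C \<subseteq> P" using plus_subset x one_in by (auto simp: C_def)
  have CC: "C \<odot> C = C"
    using plus_one_antitone[of x x] x times_idem by (simp add: C_def)
  \<comment> \<open>\<open>zero\<close> is a lower bound of \<open>C\<close>, so it lies below a
    maximal one, which is a member of \<open>C \<odot> C = C\<close>.\<close>
  have "C \<noteq> {}"
    using lower_below_times[OF CP CP zero_in_lower] CC CP by auto
  \<comment> \<open>Members of \<open>C = C \<odot> C\<close> are lower bounds of \<open>C\<close>,
    hence below one another.\<close>
  moreover have "a = b" if "a \<in> C" "b \<in> C" for a b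
  proof -
    have "a \<in> lower C" "b \<in> lower C"
      using that mem_times_lower[OF CP CP] by (auto simp: CC)
    then show ?thesis using that by (auto simp: lower_def intro: below_antisym)
  qed
  ultimately have "\<exists>x'. C = {x'}" by blast
  then show ?thesis using CP by (auto simp: C_def)
qed

lemma plus_one: "x \<in> P \<Longrightarrow> {x} \<oplus> {one} = {compl x}"
  using plus_one_singleton[of x] unfolding compl_def by (metis the_elem_eq)

lemma compl_in: "x \<in> P \<Longrightarrow> compl x \<in> P"
  using plus_one_singleton[of x] unfolding compl_def by (metis the_elem_eq)

lemma compl_compl: "x \<in> P \<Longrightarrow> compl (compl x) = x"
  using plus_one_plus_one[of x] by (simp add: plus_one compl_in)

lemma compl_antitone: "\<lbrakk>x \<in> P; y \<in> P; x \<preceq> y\<rbrakk> \<Longrightarrow> compl y \<preceq> compl x"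
  using plus_one_antitone[of x y] times_commute[of "compl x" "compl y"]
  by (simp add: below_def plus_one compl_in)

lemma times_compl: "x \<in> P \<Longrightarrow> {x} \<odot> {compl x} = {zero}"
  using times_plus_one[of x] by (simp add: plus_one)

text \<open>By axiom (iv) the only maximal lower bound of \<open>x\<close> and
  \<open>compl x\<close> is \<open>zero\<close>, and every lower bound lies below a maximal
  one.\<close>

lemma disjoint_compl:
  assumes "x \<in> P" "t \<in> P" "t \<preceq> x" "t \<preceq> compl x"
  shows "t = zero"
proof -
  have "t \<in> lower ({x} \<union> {compl x})" using assms by (simp add: lower_def)
  then show ?thesis
    using lower_below_times[of "{x}" "{compl x}"] assms(1,2) times_compl
    by (auto simp: compl_in intro: below_zero)
qed

lemma compl_zero: "compl zero = one"
proof -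
  have "zero \<preceq> compl one" using zero_below one_in compl_in by blast
  then have "compl (compl one) \<preceq> compl zero"
    using compl_antitone compl_in one_in zero_in by blast
  then show ?thesis
    using below_antisym[of one "compl zero"] below_one[of "compl zero"]
      one_in zero_in compl_in compl_compl by simp
qed

section \<open>The cut \<open>E x y\<close> of the overview, and distributivity\<close>

definition join_cut :: "'a \<Rightarrow> 'a \<Rightarrow> 'a set"
  where "join_cut x y = lower (({compl x} \<odot> {compl y}) \<oplus> {one})"

lemma join_cut_commute: "\<lbrakk>x \<in> P; y \<in> P\<rbrakk> \<Longrightarrow> join_cut x y = join_cut y x"
  using times_commute[of "compl x" "compl y"] by (simp add: join_cut_def compl_in)

lemma plus_times_compl_subset:
  "\<lbrakk>x \<in> P; y \<in> P\<rbrakk> \<Longrightarrow> ({compl x} \<odot> {compl y}) \<oplus> {one} \<subseteq> P"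
  by (intro plus_subset times_subset) (auto simp: compl_in one_in)

text \<open>Axiom (v) in terms of lower bounds: the factor \<open>{z}\<close> restricts to elements
  below \<open>z\<close>, the factor \<open>{one}\<close> restricts nothing.\<close>

lemma join_cut_below:
  assumes "x \<in> P" "y \<in> P" "z \<in> P"
  shows "{t \<in> join_cut x y. t \<preceq> z} =
    lower ((({x} \<odot> {z} \<oplus> {one}) \<odot> ({y} \<odot> {z} \<oplus> {one})) \<oplus> {one})"
    (is "_ = lower ?R")
proof -
  let ?S = "({compl x} \<odot> {compl y}) \<oplus> {one}"
  have SP: "?S \<subseteq> P" by (rule plus_times_compl_subset[OF assms(1,2)])
  have RP: "?R \<subseteq> P" using assms by (intro plus_subset times_subset) (auto simp: one_in)
  have "?S \<odot> {z} = ?R \<odot> {one}"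
    using distrib[OF assms] assms by (simp add: plus_one)
  then have "lower (?S \<union> {z}) = lower (?R \<union> {one})"
    using lower_eq_times[OF SP, of "{z}"] lower_eq_times[OF RP, of "{one}"] assms one_in by simp
  moreover have "lower (?R \<union> {one}) = lower ?R"
    by (auto simp: lower_def below_one)
  moreover have "lower (?S \<union> {z}) = {t \<in> join_cut x y. t \<preceq> z}"
    by (auto simp: lower_def join_cut_def)
  ultimately show ?thesis by simp
qed

lemma join_cut_below_compl:
  assumes y: "y \<in> P" and z: "z \<in> P"
  shows "{t \<in> join_cut (compl z) y. t \<preceq> z} = {t \<in> P. t \<preceq> y \<and> t \<preceq> z}"
proof -
  \<comment> \<open>Both \<open>x = z'\<close> and \<open>x = 0\<close> make \<open>{x} \<odot> {z}\<close> equal to \<open>{0}\<close>, and \<open>join_cut 0 y = L(y)\<close>.\<close>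
  have "{compl z} \<odot> {z} = {zero} \<odot> {z}"
    using times_compl[OF z] times_commute[of z "compl z"] times_commute[of zero z] z
    by (simp add: compl_in zero_in times_zero)
  then have "{t \<in> join_cut (compl z) y. t \<preceq> z} = {t \<in> join_cut zero y. t \<preceq> z}"
    using join_cut_below[of "compl z" y z] join_cut_below[of zero y z] y z
    by (simp add: compl_in zero_in)
  also have "join_cut zero y = lower {y}"
    using y times_commute[of one "compl y"]
    by (simp add: join_cut_def compl_zero one_in compl_in times_one plus_one compl_compl)
  finally show ?thesis by (auto simp: lower_def)
qed

text \<open>The criterion by which the inequalities in the rest of this part are reduced to
  disjointness checks.\<close>

lemma below_if_disjoint_compl:
  assumes y: "y \<in> P" and z: "z \<in> P"
    and disj: "\<And>t. \<lbrakk>t \<in> P; t \<preceq> z; t \<preceq> compl y\<rbrakk> \<Longrightarrow> t = zero"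
  shows "z \<preceq> y"
proof -
  have "{z} \<odot> {compl y} = {zero}" using times_eq_zero[OF z] y disj by (simp add: compl_in)
  then have "join_cut (compl z) y = lower {one}"
    using z by (simp add: join_cut_def compl_compl plus_one zero_in compl_zero)
  then have "z \<in> {t \<in> join_cut (compl z) y. t \<preceq> z}"
    using z by (simp add: lower_def below_one below_refl)
  then show ?thesis using join_cut_below_compl[OF y z] by simp
qed

text \<open>When \<open>{y} \<odot> {z}\<close> is a singleton, the right side of
  \<open>join_cut_below\<close> can be computed: \<open>m \<preceq> z\<close> turns it into
  \<open>lower {z}\<close>.\<close>

lemma mem_join_cut_if_meet:
  assumes "x \<in> P" "y \<in> P" "z \<in> P" "m \<in> P" "z \<preceq> x" "{y} \<odot> {z} = {m}"
  shows "z \<in> join_cut x y"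
proof -
  have xz: "{x} \<odot> {z} = {z}" using assms times_commute[of x z] by (simp add: below_def)
  have "m \<in> {y} \<odot> {z}" using assms by simp
  then have "m \<preceq> z" using mem_times_lower[of "{y}" "{z}" m] assms by (auto simp: lower_def)
  then have "{compl z} \<odot> {compl m} = {compl z}"
    using compl_antitone[of m z] assms by (simp add: below_def)
  then have "{t \<in> join_cut x y. t \<preceq> z} = lower {z}"
    using join_cut_below[of x y z] assms xz by (simp add: plus_one compl_in compl_compl)
  moreover have "z \<in> lower {z}" using assms by (simp add: lower_def below_refl)
  ultimately show ?thesis by blast
qed

text \<open>The meet of \<open>x\<close> and \<open>y\<close> may not exist, so the previous lemma
  cannot be applied to \<open>x\<close> itself. For \<open>v\<close> below \<open>x\<close> and
  \<open>compl u\<close> it is applied twice: first to each \<open>t\<close> below \<open>y\<close>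
  and \<open>v\<close>, whose meet with \<open>y\<close> is \<open>t\<close>, which forces
  \<open>t = zero\<close>; then to \<open>v\<close>, whose meet with \<open>y\<close> is therefore
  \<open>zero\<close>.\<close>

lemma mem_join_cut:
  assumes x: "x \<in> P" and y: "y \<in> P"
  shows "x \<in> join_cut x y"
proof -
  have "x \<preceq> u" if u: "u \<in> ({compl x} \<odot> {compl y}) \<oplus> {one}" for u
  proof (rule below_if_disjoint_compl[OF _ x])
    note plus_times_compl_subset[OF x y]
    then show uP: "u \<in> P" using u by blast
    have cut_u: "t \<preceq> u" if "t \<in> join_cut x y" for t
      using that u by (simp add: join_cut_def lower_def)
    fix v assume v: "v \<in> P" "v \<preceq> x" "v \<preceq> compl u"
    have "{y} \<odot> {v} = {zero}"
    proof (rule times_eq_zero[OF y v(1)])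
      fix t assume t: "t \<in> P" "t \<preceq> y" "t \<preceq> v"
      have tx: "t \<preceq> x" and tu: "t \<preceq> compl u"
        using below_trans t v x uP compl_in by blast+
      have "{y} \<odot> {t} = {t}" using t y times_commute[of y t] by (simp add: below_def)
      then have "t \<in> join_cut x y" by (rule mem_join_cut_if_meet[OF x y t(1) t(1) tx])
      then show "t = zero" using disjoint_compl[OF uP t(1) cut_u tu] by simp
    qed
    then have "v \<in> join_cut x y" using mem_join_cut_if_meet[OF x y v(1) zero_in v(2)] by simp
    then show "v = zero" using disjoint_compl[OF uP v(1) cut_u v(3)] by simp
  qed
  then show ?thesis using x by (simp add: join_cut_def lower_def)
qed

text \<open>By \<open>join_cut_below_compl\<close> at \<open>z = compl x\<close>, an element of the
  cut below \<open>compl x\<close> lies below \<open>y\<close>; being below \<open>compl y\<close>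
  too, it is \<open>zero\<close>.\<close>

lemma join_cut_disjoint:
  assumes x: "x \<in> P" and y: "y \<in> P"
    and t: "t \<in> join_cut x y" "t \<preceq> compl x" "t \<preceq> compl y"
  shows "t = zero"
proof -
  have tP: "t \<in> P" using t by (simp add: join_cut_def lower_def)
  have "t \<in> {t \<in> join_cut (compl (compl x)) y. t \<preceq> compl x}"
    using t x by (simp add: compl_compl)
  then have "t \<preceq> y" using join_cut_below_compl[OF y compl_in[OF x]] by simp
  then show ?thesis using disjoint_compl[OF y tP] t by simp
qed

text \<open>The right side is \<open>LU(x, y)\<close>. It lies in the cut because, by
  \<open>mem_join_cut\<close>, all members of the sum are upper bounds of \<open>x\<close> and
  \<open>y\<close>. Conversely, an element of the cut below \<open>compl u\<close> is below
  \<open>compl x\<close> and \<open>compl y\<close>, hence \<open>zero\<close>.\<close>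

lemma join_cut_eq:
  assumes x: "x \<in> P" and y: "y \<in> P"
  shows "join_cut x y = lower {u \<in> P. x \<preceq> u \<and> y \<preceq> u}"
proof (intro equalityI subsetI)
  fix e assume e: "e \<in> join_cut x y"
  then have eP: "e \<in> P" by (simp add: join_cut_def lower_def)
  have "e \<preceq> u" if u: "u \<in> P" "x \<preceq> u" "y \<preceq> u" for u
  proof (rule below_if_disjoint_compl[OF u(1) eP])
    fix t assume t: "t \<in> P" "t \<preceq> e" "t \<preceq> compl u"
    note plus_times_compl_subset[OF x y]
    then have "t \<in> join_cut x y"
      using e t eP below_trans[OF t(1) eP _ t(2)] by (auto simp: join_cut_def lower_def)
    moreover have "t \<preceq> compl x" "t \<preceq> compl y"
      using below_trans[OF t(1) _ _ t(3)] compl_antitone u x y compl_in by blast+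
    ultimately show "t = zero" by (rule join_cut_disjoint[OF x y])
  qed
  then show "e \<in> lower {u \<in> P. x \<preceq> u \<and> y \<preceq> u}" using eP by (simp add: lower_def)
next
  fix e assume e: "e \<in> lower {u \<in> P. x \<preceq> u \<and> y \<preceq> u}"
  note plus_times_compl_subset[OF x y]
  then show "e \<in> join_cut x y"
    using e mem_join_cut[OF x y] mem_join_cut[OF y x, folded join_cut_commute[OF x y]]
    by (auto simp: join_cut_def lower_def)
qed

text \<open>The nontrivial inclusion of distributivity, with \<open>u\<close> an upper bound of
  \<open>L(x, z)\<close> and \<open>L(y, z)\<close>.\<close>

lemma distributive_below:
  assumes x: "x \<in> P" and y: "y \<in> P" and z: "z \<in> P"
    and e: "e \<in> lower {u \<in> P. x \<preceq> u \<and> y \<preceq> u}" "e \<preceq> z"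
    and u: "u \<in> P"
      "\<And>t. \<lbrakk>t \<in> P; t \<preceq> x; t \<preceq> z\<rbrakk> \<Longrightarrow> t \<preceq> u"
      "\<And>t. \<lbrakk>t \<in> P; t \<preceq> y; t \<preceq> z\<rbrakk> \<Longrightarrow> t \<preceq> u"
  shows "e \<preceq> u"
proof -
  have eP: "e \<in> P" using e by (simp add: lower_def)
  show ?thesis
  proof (rule below_if_disjoint_compl[OF u(1) eP])
    fix t assume t: "t \<in> P" "t \<preceq> e" "t \<preceq> compl u"
    have tz: "t \<preceq> z" using below_trans[OF t(1) eP z] t e by blast
    have tE: "t \<in> join_cut x y"
      unfolding join_cut_eq[OF x y]
      using e t eP below_trans[OF t(1) eP _ t(2)] by (auto simp: lower_def)
    \<comment> \<open>Used for \<open>w = x\<close> and \<open>w = y\<close>: anything below both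
      \<open>t\<close> and \<open>w\<close> is below \<open>z\<close>, hence below \<open>u\<close>,
      but also below \<open>compl u\<close>.\<close>
    have disj: "t \<preceq> compl w"
      if w: "w \<in> P" "\<And>t. \<lbrakk>t \<in> P; t \<preceq> w; t \<preceq> z\<rbrakk> \<Longrightarrow> t \<preceq> u" for w
    proof (rule below_if_disjoint_compl[OF compl_in[OF w(1)] t(1)])
      fix s assume s: "s \<in> P" "s \<preceq> t" "s \<preceq> compl (compl w)"
      have "s \<preceq> u"
        using w s below_trans[OF s(1) t(1) z s(2) tz] by (simp add: compl_compl)
      moreover have "s \<preceq> compl u"
        using below_trans[OF s(1) t(1) _ s(2) t(3)] u(1) compl_in by simp
      ultimately show "s = zero" using disjoint_compl[OF u(1) s(1)] by simp
    qed
    show "t = zero"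
      using join_cut_disjoint[OF x y tE disj[OF x u(2)] disj[OF y u(3)]] by simp
  qed
qed

section \<open>Assembling the Boolean poset\<close>

lemma is_boolean_poset:
  "boolean_poset \<lparr>carrier = P, eq = (=), le = (\<lambda>x y. {x} \<odot> {y} = {x})\<rparr>
    (\<lambda>x. the_elem ({x} \<oplus> {one})) zero one"
  unfolding below_def[symmetric] compl_def[symmetric]
proof -
  let ?L = "\<lparr>carrier = P, eq = (=), le = (\<preceq>)\<rparr>"
  show "boolean_poset ?L compl zero one"
  proof (unfold_locales; (simp only: gorder.simps partial_object.simps eq_object.simps)?)
    show "x \<preceq> x" if "x \<in> P" for x using that by (rule below_refl)
    show "x = y" if "x \<preceq> y" "y \<preceq> x" "x \<in> P" "y \<in> P" for x y
      using that below_antisym by blast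
    show "x \<preceq> z" if "x \<preceq> y" "y \<preceq> z" "x \<in> P" "y \<in> P" "z \<in> P" for x y z
      using that below_trans by blast
    show "zero \<in> P" by (rule zero_in)
    show "one \<in> P" by (rule one_in)
    show "zero \<preceq> x" if "x \<in> P" for x using that by (rule zero_below)
    show "x \<preceq> one" if "x \<in> P" for x using that by (rule below_one)
    show "compl x \<in> P" if "x \<in> P" for x using that by (rule compl_in)
    show "compl y \<preceq> compl x" if "x \<in> P" "y \<in> P" "x \<preceq> y" for x y
      using that by (rule compl_antitone)
    show "compl (compl x) = x" if "x \<in> P" for x using that by (rule compl_compl)
    show "Lower ?L {x, compl x} = {zero}" if "x \<in> P" for x
      using that by (auto simp: Lower_def zero_in zero_below compl_in intro: disjoint_compl)
    show "Upper ?L {x, compl x} = {one}" if x: "x \<in> P" for x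
    proof -
      \<comment> \<open>By duality: \<open>compl u\<close> is a common lower bound of
        \<open>x\<close> and \<open>compl x\<close>.\<close>
      have "u = one" if u: "u \<in> P" "x \<preceq> u" "compl x \<preceq> u" for u
      proof -
        have "compl u \<preceq> compl x" "compl u \<preceq> x"
          using compl_antitone[of x u] compl_antitone[of "compl x" u] x u
          by (simp_all add: compl_in compl_compl)
        then have "compl u = zero" using disjoint_compl[OF x] u by (simp add: compl_in)
        then show ?thesis using compl_compl[OF u(1)] by (simp add: compl_zero)
      qed
      then show ?thesis using x one_in below_one compl_in by (auto simp: Upper_def)
    qed
    show "Lower ?L (Upper ?L {x, y} \<union> {z}) =
        Lower ?L (Upper ?L (Lower ?L {x, z} \<union> Lower ?L {y, z}))"
      if xyz: "x \<in> P" "y \<in> P" "z \<in> P" for x y z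
    proof (intro equalityI subsetI)
      fix e assume "e \<in> Lower ?L (Upper ?L {x, y} \<union> {z})"
      then have "e \<in> lower {u \<in> P. x \<preceq> u \<and> y \<preceq> u}" "e \<preceq> z" "e \<in> P"
        using xyz by (auto simp: Lower_def Upper_def lower_def)
      then show "e \<in> Lower ?L (Upper ?L (Lower ?L {x, z} \<union> Lower ?L {y, z}))"
        using distributive_below[OF xyz, of e] xyz by (auto simp: Lower_def Upper_def)
    next
      fix e assume e: "e \<in> Lower ?L (Upper ?L (Lower ?L {x, z} \<union> Lower ?L {y, z}))"
      \<comment> \<open>This inclusion holds in every poset, since \<open>Lower\<close> reverses
        inclusions.\<close>
      have "Upper ?L {x, y} \<union> {z} \<subseteq> Upper ?L (Lower ?L {x, z} \<union> Lower ?L {y, z})"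
        using xyz by (auto simp: Lower_def Upper_def intro: below_trans)
      then show "e \<in> Lower ?L (Upper ?L {x, y} \<union> {z})"
        using e by (auto simp: Lower_def)
    qed
  qed
qed

end

text \<open>The first conjunct ensures that \<open>the_elem\<close> returns the actual element
  \<open>x + 1\<close> rather than an unspecified value.\<close>

theorem theorem5p3:
  fixes P :: "'a set"
    and plus times :: "'a set \<Rightarrow> 'a set \<Rightarrow> 'a set"
    and zero one :: 'a
  assumes "dual_of_boolean_poset P plus times zero one"
    and "finite P"
  shows "(\<forall>x\<in>P. \<exists>x'\<in>P. plus {x} {one} = {x'}) \<and>
    boolean_poset
      \<lparr>carrier = P, eq = (=), le = (\<lambda>x y. times {x} {y} = {x})\<rparr>
      (\<lambda>x. the_elem (plus {x} {one})) zero one"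
proof -
  interpret finite_dual_of_boolean_poset P plus times zero one
    using assms by (simp add: finite_dual_of_boolean_poset_def finite_dual_of_boolean_poset_axioms_def)
  show ?thesis using plus_one_singleton is_boolean_poset by blast
qed

end
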